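(* Let $(f_i)_{i\ge1}$ be a sequence of $[0,1]$-valued functions on a set $X$. Suppose that the independence property is uniformly blocked for $(f_i)$, that is, there exists a natural number $N$ such that for all real numbers $r<s$ there is a set $E\subseteq\{1,\dots,N\}$ (depending only on $r,s$) such that for all indices $i_1<\dots<i_N<\omega$ we have $$\bigcap_{j\in E}[f_{i_j}\le r]\ \cap\bigcap_{j\in\{1,\dots,N\}\setminus E}[f_{i_j}\ge s]=\emptyset .$$ Then the following properties hold: (i) There exists a real number $C$ such that for all $x\in X$, $$\sum_{i=1}^\infty|f_i(x)-f_{i+1}(x)|\le C.$$ (ii) Suppose further that $X$ is a compact metric space and that the $f_i$ are continuous. Then the sequence $(f_i)$ converges pointwise to a function $f$ which is $DBSC$.
   Context: $[f\le r]=\{x\in X:f(x)\le r\}$ and $[f\ge s]=\{x\in X:f(x)\ge s\}$. A real-valued function $f$ on a compact metric space $X$ is $DBSC$ (difference of bounded semi-continuous functions) if there are bounded semi-continuous functions $F_1,F_2$ on $X$ with $f=F_1-F_2$. *)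

theory Defs
  imports "HOL-Analysis.Analysis"
begin

definition sublevel :: "'a set \<Rightarrow> ('a \<Rightarrow> real) \<Rightarrow> real \<Rightarrow> 'a set" where
  "sublevel X f r = {x \<in> X. f x \<le> r}"

definition suplevel :: "'a set \<Rightarrow> ('a \<Rightarrow> real) \<Rightarrow> real \<Rightarrow> 'a set" where
  "suplevel X f s = {x \<in> X. f x \<ge> s}"

(* Sequences are indexed by the positive naturals; the value f 0 is never used.
   A tuple i_1 < ... < i_N is a function i restricted to {1..N}.
   Intersections are taken inside X, so the empty intersection is X. *)
definition uniformly_blocked :: "'a set \<Rightarrow> (nat \<Rightarrow> 'a \<Rightarrow> real) \<Rightarrow> bool" where
  "uniformly_blocked X f \<longleftrightarrow>
    (\<exists>N::nat. \<forall>r s::real. r < s \<longrightarrow>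
      (\<exists>E \<subseteq> {1..N}. \<forall>i::nat \<Rightarrow> nat.
        i ` {1..N} \<subseteq> {1..} \<longrightarrow> strict_mono_on {1..N} i \<longrightarrow>
        X \<inter> (\<Inter>j\<in>E. sublevel X (f (i j)) r)
          \<inter> (\<Inter>j\<in>{1..N} - E. suplevel X (f (i j)) s) = {}))"

definition lower_semicontinuous :: "'a topology \<Rightarrow> ('a \<Rightarrow> real) \<Rightarrow> bool" where
  "lower_semicontinuous T g \<longleftrightarrow> (\<forall>a. openin T {x \<in> topspace T. g x > a})"

definition upper_semicontinuous :: "'a topology \<Rightarrow> ('a \<Rightarrow> real) \<Rightarrow> bool" where
  "upper_semicontinuous T g \<longleftrightarrow> (\<forall>a. openin T {x \<in> topspace T. g x < a})"

definition semicontinuous :: "'a topology \<Rightarrow> ('a \<Rightarrow> real) \<Rightarrow> bool" where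
  "semicontinuous T g \<longleftrightarrow> lower_semicontinuous T g \<or> upper_semicontinuous T g"

(* Requiring both functions to be lower semicontinuous (or both upper) would give the same
   class: f = F1 - F2 = (-F2) - (-F1), and in the mixed cases f = F1 - F2 is itself
   bounded and semicontinuous, so f = f - 0. *)
definition DBSC :: "'a topology \<Rightarrow> ('a \<Rightarrow> real) \<Rightarrow> bool" where
  "DBSC T f \<longleftrightarrow>
    (\<exists>F1 F2. semicontinuous T F1 \<and> bounded (F1 ` topspace T) \<and>
             semicontinuous T F2 \<and> bounded (F2 ` topspace T) \<and>
             (\<forall>x \<in> topspace T. f x = F1 x - F2 x))"

end

theory Submission
  imports Defs
begin

text \<open>
  The engine is a discrete form of Banach's indicatrix formula: the variation of a real
  sequence \<open>a\<close> is the integral over all levels \<open>t\<close> of the number of times that \<open>a\<close> crosses \<open>t\<close>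
  (lemma \<open>variation_le_crossings\<close>).

  Fix a point \<open>x\<close>, a level \<open>t\<close> and finitely many terms of \<open>f i x\<close>. Since only finitely many
  terms are involved, there is an \<open>r < t\<close> such that each of them is either \<open>\<le> r\<close> or \<open>\<ge> t\<close>.
  If they cross \<open>t\<close> at least \<open>2 * N\<close> times, then every pattern of \<open>N\<close> instructions
  ``low'' and ``high'' can be read off along a subsequence, because each pair of consecutive
  crossings serves one instruction (lemma \<open>pattern_from_changes\<close>). This
  contradicts the blocked pattern for \<open>r < t\<close>. It is essential here that \<open>N\<close> does not depend on
  \<open>r\<close> and \<open>s\<close>, as \<open>t - r\<close> may be arbitrarily small. So there are at most \<open>2 * N\<close> crossings of each
  level, and as all values lie in the unit interval, the variation is at most \<open>2 * N\<close>.

  For the second part, bounded variation gives the pointwise limit \<open>g\<close>. Let \<open>V\<close> be the total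
  variation as a function of \<open>x\<close>. Then \<open>g = (V + g) - V\<close>, and both \<open>V\<close> and \<open>V + g\<close> are limits of
  increasing sequences of continuous functions, hence lower semicontinuous: in the second case
  the functions are the partial variation up to \<open>f n\<close> plus \<open>f n\<close>, and a step adds
  \<open>\<bar>f n - f (n + 1)\<bar> - (f n - f (n + 1)) \<ge> 0\<close>.
\<close>

section \<open>Crossings and variation\<close>

text \<open>
  The change points are listed in increasing order as \<open>h 0 < h 1 < \<dots>\<close>. At \<open>h (2 * j)\<close> and its
  successor \<open>P\<close> takes both truth values, so one of the two satisfies the \<open>j\<close>-th instruction.
  Skipping \<open>h (2 * j + 1)\<close> leaves room for the successor before the next choice is made.
\<close>

lemma pattern_from_changes:
  fixes P Q :: "nat \<Rightarrow> bool"
  assumes fin: "finite M" and changes: "\<And>i. i \<in> M \<Longrightarrow> P i \<noteq> P (Suc i)"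
    and card: "2 * k \<le> card M"
  obtains c where "strict_mono_on {..<k} c" "c ` {..<k} \<subseteq> M \<union> Suc ` M"
    "\<And>j. j < k \<Longrightarrow> P (c j) = Q j"
proof -
  obtain h where h: "bij_betw h {..<card M} M" "strict_mono_on {..<card M} h"
    using ex_bij_betw_strict_mono_card[OF fin] .
  define c where "c j = (if P (h (2 * j)) = Q j then h (2 * j) else Suc (h (2 * j)))" for j
  have inM: "h i \<in> M" if "i < card M" for i
    using h(1) that by (auto simp: bij_betw_def)
  have less: "h i < h j" if "i < j" "j < card M" for i j
    using h(2) that by (auto simp: strict_mono_on_def)
  show thesis
  proof
    show "strict_mono_on {..<k} c"
    proof (rule strict_mono_onI)
      fix i j assume ij: "i \<in> {..<k}" "j \<in> {..<k}" "i < j"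
      have "h (2 * i) < h (2 * i + 1)"
        using ij card by (intro less) auto
      moreover have "h (2 * i + 1) < h (2 * j)"
        using ij card by (intro less) auto
      ultimately show "c i < c j"
        by (simp add: c_def)
    qed
    show "c ` {..<k} \<subseteq> M \<union> Suc ` M"
    proof (rule image_subsetI)
      fix j assume "j \<in> {..<k}"
      then have "h (2 * j) \<in> M"
        using card by (intro inM) simp
      then show "c j \<in> M \<union> Suc ` M"
        by (simp add: c_def)
    qed
    show "P (c j) = Q j" if "j < k" for j
    proof -
      have "P (h (2 * j)) \<noteq> P (Suc (h (2 * j)))"
        using that card by (intro changes inM) simp
      then show ?thesis
        by (cases "P (h (2 * j)) = Q j") (auto simp: c_def)
    qed
  qed
qed

text \<open>
  Levels are compared by \<open>\<le>\<close> and \<open><\<close>, so that a jump from \<open>u\<close> to \<open>v\<close> crosses exactly the levels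
  in the half-open interval between them, a set of measure \<open>\<bar>u - v\<bar>\<close>. Summing the
  indicators of these intervals counts the crossings of each level.
\<close>

lemma variation_le_crossings:
  fixes a :: "nat \<Rightarrow> real"
  assumes "l \<le> u" and range: "\<And>i. i \<le> n \<Longrightarrow> a i \<in> {l..u}"
    and crossings: "\<And>t. card {i. i < n \<and> (t \<le> a i) \<noteq> (t \<le> a (Suc i))} \<le> K"
  shows "(\<Sum>i<n. \<bar>a i - a (Suc i)\<bar>) \<le> K * (u - l)"
proof -
  define J where "J i = {min (a i) (a (Suc i))<..max (a i) (a (Suc i))}" for i
  have J: "t \<in> J i \<longleftrightarrow> (t \<le> a i) \<noteq> (t \<le> a (Suc i))" for t i
    by (auto simp: J_def)
  have "(\<Sum>i<n. \<bar>a i - a (Suc i)\<bar>) = (\<Sum>i<n. \<integral>t. indicator (J i) t \<partial>lborel)"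
    by (intro sum.cong refl) (auto simp: J_def max_def min_def)
  also have "\<dots> = (\<integral>t. (\<Sum>i<n. indicator (J i) t) \<partial>lborel)"
    by (rule Bochner_Integration.integral_sum[symmetric])
       (auto simp: J_def min_def max_def)
  also have "\<dots> \<le> (\<integral>t. real K * indicator {l..u} t \<partial>lborel)"
  proof (rule integral_mono)
    show "integrable lborel (\<lambda>t. \<Sum>i<n. indicator (J i) t :: real)"
      by (intro Bochner_Integration.integrable_sum) (auto simp: J_def min_def max_def)
    show "integrable lborel (\<lambda>t. real K * indicator {l..u} t :: real)"
      by (intro integrable_mult_right integrable_real_indicator) (auto simp: \<open>l \<le> u\<close>)
    fix t :: real
    have count: "(\<Sum>i<n. indicator (J i) t :: real)
        = card {i. i < n \<and> (t \<le> a i) \<noteq> (t \<le> a (Suc i))}"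
      by (auto simp: indicator_def J sum.If_cases Int_def lessThan_def)
    show "(\<Sum>i<n. indicator (J i) t) \<le> real K * indicator {l..u} t"
    proof (cases "t \<in> {l..u}")
      case True
      then show ?thesis using count crossings[of t] by simp
    next
      case False
      have "t \<notin> J i" if "i < n" for i
        using range[of i] range[of "Suc i"] that False by (auto simp: J_def)
      then show ?thesis by (simp add: indicator_def)
    qed
  qed
  also have "\<dots> = K * (u - l)"
    using \<open>l \<le> u\<close> by simp
  finally show ?thesis .
qed

text \<open>
  This turns a single level \<open>t\<close> into a pair \<open>r < t\<close> to which the blocking condition applies:
  for the members of a finite set, being below \<open>t\<close> is the same as being at most \<open>r\<close>.
\<close>

lemma finite_gap_below:
  fixes t :: "'b :: {linorder, no_bot}"
  assumes "finite A"
  obtains r where "r < t" "\<And>y. y \<in> A \<Longrightarrow> y < t \<Longrightarrow> y \<le> r"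
proof (cases "{y \<in> A. y < t} = {}")
  case True
  then show thesis using that lt_ex[of t] by auto
next
  case False
  then have "Max {y \<in> A. y < t} \<in> {y \<in> A. y < t}"
    using assms by (intro Max_in) auto
  then show thesis
    using that[of "Max {y \<in> A. y < t}"] assms by auto
qed

lemma partial_variation_bounded_if_uniformly_blocked:
  fixes f :: "nat \<Rightarrow> 'a \<Rightarrow> real"
  assumes range: "\<And>i x. i \<ge> 1 \<Longrightarrow> x \<in> X \<Longrightarrow> f i x \<in> {0..1}"
    and blocked: "uniformly_blocked X f"
  obtains K :: nat
  where "\<And>x n. x \<in> X \<Longrightarrow> (\<Sum>i<n. \<bar>f (i + 1) x - f (i + 2) x\<bar>) \<le> real K"
proof -
  obtain N where N: "\<And>r s :: real. r < s \<Longrightarrow> \<exists>E \<subseteq> {1..N}. \<forall>i :: nat \<Rightarrow> nat.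
        i ` {1..N} \<subseteq> {1..} \<longrightarrow> strict_mono_on {1..N} i \<longrightarrow>
        X \<inter> (\<Inter>j\<in>E. sublevel X (f (i j)) r)
          \<inter> (\<Inter>j\<in>{1..N} - E. suplevel X (f (i j)) s) = {}"
    using blocked unfolding uniformly_blocked_def by blast
  show thesis
  proof
    fix x n assume x: "x \<in> X"
    define a where "a i = f (i + 1) x" for i
    have "(\<Sum>i<n. \<bar>a i - a (Suc i)\<bar>) \<le> real (2 * N) * (1 - 0)"
    proof (rule variation_le_crossings)
      show "a i \<in> {0..1}" for i
        unfolding a_def by (rule range[OF _ x]) simp
      fix t :: real
      define M where "M = {i. i < n \<and> (t \<le> a i) \<noteq> (t \<le> a (Suc i))}"
      show "card M \<le> 2 * N"
      proof (rule ccontr)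
        assume "\<not> card M \<le> 2 * N"
        then have card: "2 * N \<le> card M" by simp
        obtain r where r: "r < t" "\<And>y. y \<in> a ` {..n} \<Longrightarrow> y < t \<Longrightarrow> y \<le> r"
          using finite_gap_below[of "a ` {..n}" t] by blast
        obtain E where E: "E \<subseteq> {1..N}" "\<And>i :: nat \<Rightarrow> nat.
            i ` {1..N} \<subseteq> {1..} \<Longrightarrow> strict_mono_on {1..N} i \<Longrightarrow>
            X \<inter> (\<Inter>j\<in>E. sublevel X (f (i j)) r)
              \<inter> (\<Inter>j\<in>{1..N} - E. suplevel X (f (i j)) t) = {}"
          using N[OF r(1)] by blast
        obtain c where c: "strict_mono_on {..<N} c" "c ` {..<N} \<subseteq> M \<union> Suc ` M"
            "\<And>j. j < N \<Longrightarrow> (t \<le> a (c j)) = (Suc j \<notin> E)"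
          using pattern_from_changes[of M "\<lambda>i. t \<le> a i" N "\<lambda>j. Suc j \<notin> E"] card
          unfolding M_def by auto
        have range_c: "c j \<le> n" if "j < N" for j
          using c(2) that by (auto simp: M_def)
        \<comment> \<open>Positions and indices both start at 1 in the blocking condition, but at 0 in \<open>c\<close> and \<open>a\<close>.\<close>
        define i where "i j = Suc (c (j - 1))" for j
        have val: "f (i j) x = a (c (j - 1))" for j
          by (simp add: i_def a_def)
        have low: "f (i j) x \<le> r" if "j \<in> E" for j
        proof -
          have j: "j - 1 < N" "Suc (j - 1) = j" using subsetD[OF E(1) that] by auto
          show ?thesis
            unfolding val using c(3)[OF j(1)] range_c[OF j(1)] that j(2)
            by (intro r(2)) auto
        qed
        have high: "t \<le> f (i j) x" if "j \<in> {1..N} - E" for j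
        proof -
          have j: "j - 1 < N" "Suc (j - 1) = j" using that by auto
          show ?thesis
            unfolding val using c(3)[OF j(1)] that j(2) by auto
        qed
        have "strict_mono_on {1..N} i"
        proof (rule strict_mono_onI)
          fix j k assume jk: "j \<in> {1..N}" "k \<in> {1..N}" "j < k"
          then have "j - 1 < k - 1" "k - 1 < N" by auto
          then show "i j < i k"
            using strict_mono_onD[OF c(1), of "j - 1" "k - 1"] by (simp add: i_def)
        qed
        moreover have "i ` {1..N} \<subseteq> {1..}"
          by (auto simp: i_def)
        ultimately have "X \<inter> (\<Inter>j\<in>E. sublevel X (f (i j)) r)
              \<inter> (\<Inter>j\<in>{1..N} - E. suplevel X (f (i j)) t) = {}"
          using E(2) by blast
        then show False
          using x low high by (auto simp: sublevel_def suplevel_def)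
      qed
    qed simp
    then show "(\<Sum>i<n. \<bar>f (i + 1) x - f (i + 2) x\<bar>) \<le> real (2 * N)"
      by (simp add: a_def)
  qed
qed

section \<open>Semicontinuity and the pointwise limit\<close>

text \<open>
  A superlevel set of the limit is the union of the superlevel sets of the approximations.
\<close>

lemma lower_semicontinuous_increasing_limit:
  fixes p :: "nat \<Rightarrow> 'a \<Rightarrow> real"
  assumes cont: "\<And>n. continuous_map T euclideanreal (p n)"
    and mono: "\<And>x. x \<in> topspace T \<Longrightarrow> incseq (\<lambda>n. p n x)"
    and lim: "\<And>x. x \<in> topspace T \<Longrightarrow> (\<lambda>n. p n x) \<longlonglongrightarrow> F x"
  shows "lower_semicontinuous T F"
  unfolding lower_semicontinuous_def
proof
  fix b
  have "(b < F x) = (\<exists>n. b < p n x)" if "x \<in> topspace T" for x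
  proof
    assume "b < F x"
    then have "\<forall>\<^sub>F n in sequentially. b < p n x"
      by (rule order_tendstoD(1)[OF lim[OF that]])
    then show "\<exists>n. b < p n x"
      by (auto simp: eventually_sequentially)
  next
    assume "\<exists>n. b < p n x"
    then show "b < F x"
      using incseq_le[OF mono lim] that by (auto intro: less_le_trans)
  qed
  then have "{x \<in> topspace T. b < F x} = (\<Union>n. {x \<in> topspace T. p n x \<in> {b<..}})"
    by auto
  also have "openin T \<dots>"
  proof (rule openin_Union)
    show "openin T S" if "S \<in> range (\<lambda>n. {x \<in> topspace T. p n x \<in> {b<..}})" for S
    proof -
      obtain n where "S = {x \<in> topspace T. p n x \<in> {b<..}}"
        using \<open>S \<in> _\<close> by blast
      moreover have "openin T {x \<in> topspace T. p n x \<in> {b<..}}"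
        using cont by (rule openin_continuous_map_preimage) simp
      ultimately show ?thesis by simp
    qed
  qed
  finally show "openin T {x \<in> topspace T. b < F x}" .
qed

text \<open>
  The limit is written as \<open>(V + g) - V\<close> with the total variation \<open>V\<close>. As with the difference
  of increasing functions for a function of bounded variation, the variation dominates the
  oscillation of \<open>h\<close>, which makes the approximations of \<open>V + g\<close> increase.
\<close>

lemma DBSC_limit_of_bounded_variation:
  fixes h :: "nat \<Rightarrow> 'a \<Rightarrow> real"
  assumes cont: "\<And>n. continuous_map T euclideanreal (h n)"
    and bound: "\<And>n x. x \<in> topspace T \<Longrightarrow> \<bar>h n x\<bar> \<le> B"
    and variation: "\<And>n x. x \<in> topspace T \<Longrightarrow> (\<Sum>i<n. \<bar>h i x - h (Suc i) x\<bar>) \<le> C"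
  obtains g where "\<And>x. x \<in> topspace T \<Longrightarrow> (\<lambda>n. h n x) \<longlonglongrightarrow> g x" "DBSC T g"
proof -
  define v where "v n x = (\<Sum>i<n. \<bar>h i x - h (Suc i) x\<bar>)" for n x
  define V where "V x = (\<Sum>i. \<bar>h i x - h (Suc i) x\<bar>)" for x
  define g where "g x = lim (\<lambda>n. h n x)" for x
  have summable: "summable (\<lambda>i. \<bar>h i x - h (Suc i) x\<bar>)" if "x \<in> topspace T" for x
    using variation[OF that]
    by (intro summableI_nonneg_bounded[of _ C]) auto
  have V: "(\<lambda>n. v n x) \<longlonglongrightarrow> V x" if "x \<in> topspace T" for x
    unfolding v_def V_def using summable[OF that] by (rule summable_LIMSEQ)
  have g: "(\<lambda>n. h n x) \<longlonglongrightarrow> g x" if "x \<in> topspace T" for x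
  proof -
    have "summable (\<lambda>i. h i x - h (Suc i) x)"
      using summable[OF that] by (rule summable_rabs_cancel)
    then have "(\<lambda>n. h 0 x - (\<Sum>i<n. h i x - h (Suc i) x)) \<longlonglongrightarrow> h 0 x - (\<Sum>i. h i x - h (Suc i) x)"
      by (intro tendsto_intros summable_LIMSEQ)
    then have "convergent (\<lambda>n. h n x)"
      using sum_lessThan_telescope'[of "\<lambda>i. h i x"] by (auto simp: convergent_def)
    then show ?thesis
      unfolding g_def by (simp add: convergent_LIMSEQ_iff)
  qed
  have cont_v: "continuous_map T euclideanreal (v n)" for n
    unfolding v_def using cont
    by (intro continuous_map_sum continuous_map_real_abs continuous_map_diff) auto
  have V_lsc: "lower_semicontinuous T V"
    by (rule lower_semicontinuous_increasing_limit[OF cont_v _ V])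
       (auto simp: incseq_Suc_iff v_def)
  have V_g_lsc: "lower_semicontinuous T (\<lambda>x. V x + g x)"
  proof (rule lower_semicontinuous_increasing_limit[where p = "\<lambda>n x. v n x + h n x"])
    show "continuous_map T euclideanreal (\<lambda>x. v n x + h n x)" for n
      by (intro continuous_map_add cont_v cont)
    show "incseq (\<lambda>n. v n x + h n x)" for x
      by (auto simp: incseq_Suc_iff v_def)
    show "(\<lambda>n. v n x + h n x) \<longlonglongrightarrow> V x + g x" if "x \<in> topspace T" for x
      by (intro tendsto_add V g that)
  qed
  have V_bound: "\<bar>V x\<bar> \<le> C" if "x \<in> topspace T" for x
  proof -
    have "V x \<le> C"
      using V[OF that] by (rule LIMSEQ_le_const2) (use variation[OF that] in \<open>auto simp: v_def\<close>)
    moreover have "0 \<le> V x"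
      unfolding V_def using summable[OF that] by (rule suminf_nonneg) simp
    ultimately show ?thesis by simp
  qed
  have g_bound: "\<bar>g x\<bar> \<le> B" if "x \<in> topspace T" for x
    using tendsto_rabs[OF g[OF that]] by (rule LIMSEQ_le_const2) (use bound[OF that] in auto)
  have "bounded (V ` topspace T)"
    using V_bound by (auto simp: bounded_iff)
  moreover have "bounded ((\<lambda>x. V x + g x) ` topspace T)"
    unfolding bounded_iff
  proof (intro exI ballI)
    fix y assume "y \<in> (\<lambda>x. V x + g x) ` topspace T"
    then show "norm y \<le> C + B"
      using V_bound g_bound by (fastforce intro: order_trans[OF abs_triangle_ineq] add_mono)
  qed
  ultimately have "DBSC T g"
    unfolding DBSC_def semicontinuous_def using V_lsc V_g_lsc
    by (intro exI[of _ "\<lambda>x. V x + g x"] exI[of _ V]) simp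
  with g show thesis
    using that by blast
qed

theorem lemma3p9:
  fixes X :: "'a set" and f :: "nat \<Rightarrow> 'a \<Rightarrow> real"
  assumes "\<And>i x. i \<ge> 1 \<Longrightarrow> x \<in> X \<Longrightarrow> f i x \<in> {0..1}"
    and "uniformly_blocked X f"
  shows "(\<exists>C::real. \<forall>x\<in>X.
            summable (\<lambda>n. \<bar>f (n + 1) x - f (n + 2) x\<bar>) \<and>
            (\<Sum>n. \<bar>f (n + 1) x - f (n + 2) x\<bar>) \<le> C) \<and>
         (\<forall>d :: 'a \<Rightarrow> 'a \<Rightarrow> real.
            Metric_space X d \<longrightarrow>
            compact_space (Metric_space.mtopology X d) \<longrightarrow>
            (\<forall>i\<ge>1. continuous_map (Metric_space.mtopology X d) euclideanreal (f i)) \<longrightarrow>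
            (\<exists>g :: 'a \<Rightarrow> real.
               (\<forall>x\<in>X. (\<lambda>i. f i x) \<longlonglongrightarrow> g x) \<and>
               DBSC (Metric_space.mtopology X d) g))"
proof -
  obtain K :: nat where
    K: "\<And>x n. x \<in> X \<Longrightarrow> (\<Sum>i<n. \<bar>f (i + 1) x - f (i + 2) x\<bar>) \<le> real K"
    using partial_variation_bounded_if_uniformly_blocked[OF assms] by blast
  have variation: "summable (\<lambda>n. \<bar>f (n + 1) x - f (n + 2) x\<bar>) \<and>
      (\<Sum>n. \<bar>f (n + 1) x - f (n + 2) x\<bar>) \<le> real K" if "x \<in> X" for x
  proof
    show summable: "summable (\<lambda>n. \<bar>f (n + 1) x - f (n + 2) x\<bar>)"
      using K[OF that] by (intro summableI_nonneg_bounded[of _ "real K"]) auto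
    show "(\<Sum>n. \<bar>f (n + 1) x - f (n + 2) x\<bar>) \<le> real K"
      using summable K[OF that] by (rule suminf_le_const)
  qed
  have limit: "\<exists>g. (\<forall>x\<in>X. (\<lambda>i. f i x) \<longlonglongrightarrow> g x) \<and> DBSC (Metric_space.mtopology X d) g"
    if d: "Metric_space X d"
      and cont: "\<forall>i\<ge>1. continuous_map (Metric_space.mtopology X d) euclideanreal (f i)"
    for d :: "'a \<Rightarrow> 'a \<Rightarrow> real"
  proof -
    have space: "topspace (Metric_space.mtopology X d) = X"
      using d by (rule Metric_space.topspace_mtopology)
    obtain g where g: "\<And>x. x \<in> X \<Longrightarrow> (\<lambda>n. f (Suc n) x) \<longlonglongrightarrow> g x"
        "DBSC (Metric_space.mtopology X d) g"
    proof (rule DBSC_limit_of_bounded_variation[of "Metric_space.mtopology X d"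
          "\<lambda>n. f (Suc n)" 1 "real K", unfolded space])
      show "continuous_map (Metric_space.mtopology X d) euclideanreal (f (Suc n))" for n
        using cont by simp
      show "\<bar>f (Suc n) x\<bar> \<le> 1" if "x \<in> X" for n x
        using assms(1)[of "Suc n" x] that by simp
      show "(\<Sum>i<n. \<bar>f (Suc i) x - f (Suc (Suc i)) x\<bar>) \<le> real K" if "x \<in> X" for n x
        using K[OF that, of n] by simp
    qed blast
    then show ?thesis
      by (blast intro: LIMSEQ_imp_Suc)
  qed
  show ?thesis
  proof (rule conjI)
    show "\<exists>C::real. \<forall>x\<in>X. summable (\<lambda>n. \<bar>f (n + 1) x - f (n + 2) x\<bar>) \<and>
        (\<Sum>n. \<bar>f (n + 1) x - f (n + 2) x\<bar>) \<le> C"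
      using variation by (intro exI[of _ "real K"] ballI)
  qed (rule allI, intro impI, rule limit)
qed

end
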